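(* (1) For every $m\ge2$, an independent exact $r$-cover of $\mathbb Z^m$ exists when $r\in\{0,1,2,m,2m\}$. (2) If an independent exact $r$-cover of $\mathbb Z^m$ exists, then for every $\lambda\in\mathbb N$ an independent exact $\lambda r$-cover of $\mathbb Z^{\lambda m}$ exists.
   Context: $\mathbb Z^m$ is the infinite grid graph: two points are adjacent iff they differ by $\pm1$ in exactly one coordinate (so it is $2m$-regular). For a $d$-regular graph $G$ and $0\le r\le d$, a set $S\subseteq V(G)$ is an independent exact $r$-cover if $S$ is an independent set and every vertex not in $S$ is adjacent to exactly $r$ elements of $S$. *)

theory Defs
  imports Main
begin

text \<open>
  A graph is given by a vertex set \<open>V\<close> and an adjacency relation \<open>adj\<close>, of which only the
  restriction to \<open>V\<close> matters.
\<close>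

definition regular_graph :: "'a set \<Rightarrow> ('a \<Rightarrow> 'a \<Rightarrow> bool) \<Rightarrow> nat \<Rightarrow> bool" where
  "regular_graph V adj d \<longleftrightarrow>
     (\<forall>v\<in>V. \<not> adj v v) \<and>
     (\<forall>v\<in>V. \<forall>w\<in>V. adj v w \<longrightarrow> adj w v) \<and>
     (\<forall>v\<in>V. finite {w \<in> V. adj v w} \<and> card {w \<in> V. adj v w} = d)"

definition independent_set :: "'a set \<Rightarrow> ('a \<Rightarrow> 'a \<Rightarrow> bool) \<Rightarrow> 'a set \<Rightarrow> bool" where
  "independent_set V adj S \<longleftrightarrow> S \<subseteq> V \<and> (\<forall>u\<in>S. \<forall>v\<in>S. \<not> adj u v)"

text \<open>
  The cardinality below is that of a finite set, because regularity forces all neighbourhoods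
  to be finite.
\<close>

definition independent_exact_cover ::
  "'a set \<Rightarrow> ('a \<Rightarrow> 'a \<Rightarrow> bool) \<Rightarrow> nat \<Rightarrow> 'a set \<Rightarrow> bool" where
  "independent_exact_cover V adj r S \<longleftrightarrow>
     (\<exists>d. regular_graph V adj d \<and> r \<le> d) \<and>
     independent_set V adj S \<and>
     (\<forall>v \<in> V - S. card {s \<in> S. adj v s} = r)"

text \<open>Points of \<open>\<int>\<^sup>m\<close> are integer lists of length \<open>m\<close>.\<close>

definition grid_points :: "nat \<Rightarrow> int list set" where
  "grid_points m = {x. length x = m}"

definition grid_adj :: "int list \<Rightarrow> int list \<Rightarrow> bool" where
  "grid_adj x y \<longleftrightarrow> length x = length y \<and>
     (\<exists>i<length x. \<bar>x ! i - y ! i\<bar> = 1 \<and> (\<forall>j<length x. j \<noteq> i \<longrightarrow> x ! j = y ! j))"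

lemma regular_graph_grid: "regular_graph (grid_points m) grid_adj (2 * m)"
proof -
  have irrefl: "\<not> grid_adj v v" for v
    by (simp add: grid_adj_def)
  have sym: "grid_adj w v" if "grid_adj v w" for v w
  proof -
    from that obtain i where "length v = length w" "i < length v" "\<bar>v ! i - w ! i\<bar> = 1"
      "\<forall>j<length v. j \<noteq> i \<longrightarrow> v ! j = w ! j"
      unfolding grid_adj_def by blast
    then show ?thesis
      unfolding grid_adj_def by (intro conjI exI[of _ i]) (simp_all add: abs_minus_commute)
  qed
  have nbrs: "finite {w \<in> grid_points m. grid_adj v w} \<and>
      card {w \<in> grid_points m. grid_adj v w} = 2 * m" if "v \<in> grid_points m" for v
  proof -
    let ?D = "{..<m} \<times> {-1, 1::int}"
    define f where "f = (\<lambda>(i, e). v[i := v ! i + e])"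
    have len: "length v = m" using that by (simp add: grid_points_def)
    have inj: "inj_on f ?D"
    proof (rule inj_onI)
      fix p q assume p: "p \<in> ?D" and q: "q \<in> ?D" and eq: "f p = f q"
      obtain i e where p': "p = (i, e)" by (cases p)
      obtain k g where q': "q = (k, g)" by (cases q)
      have "v[i := v ! i + e] ! i = v[k := v ! k + g] ! i"
        using eq by (simp add: f_def p' q')
      with p q len show "p = q"
        by (auto simp: p' q' nth_list_update split: if_splits)
    qed
    have img: "f ` ?D = {w \<in> grid_points m. grid_adj v w}"
    proof (intro equalityI subsetI)
      fix w assume "w \<in> f ` ?D"
      then obtain i e where "i < m" "e \<in> {-1, 1}" "w = v[i := v ! i + e]"
        by (auto simp: f_def)
      with len show "w \<in> {w \<in> grid_points m. grid_adj v w}"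
        by (auto simp: grid_points_def grid_adj_def intro!: exI[of _ i])
    next
      fix w assume "w \<in> {w \<in> grid_points m. grid_adj v w}"
      then have lw: "length w = m" and adj: "grid_adj v w"
        by (simp_all add: grid_points_def)
      from adj obtain i where "i < length v" and diff: "\<bar>v ! i - w ! i\<bar> = 1"
        and same: "\<forall>j<length v. j \<noteq> i \<longrightarrow> v ! j = w ! j"
        unfolding grid_adj_def by blast
      then have im: "i < m" by (simp only: len)
      have "w = f (i, w ! i - v ! i)"
        unfolding f_def prod.case
      proof (rule nth_equalityI)
        show "length w = length (v[i := v ! i + (w ! i - v ! i)])"
          by (simp only: lw len length_list_update)
        show "w ! j = v[i := v ! i + (w ! i - v ! i)] ! j" if "j < length w" for j
        proof (cases "j = i")
          case True
          then show ?thesis using im len by simp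
        next
          case False
          then have "v ! j = w ! j" using same that unfolding lw len by blast
          then show ?thesis using False by simp
        qed
      qed
      moreover have "w ! i - v ! i \<in> {-1, 1}" using diff
        by (simp add: abs_if split: if_splits) linarith?
      ultimately show "w \<in> f ` ?D" using im
        by (intro image_eqI[where x = "(i, w ! i - v ! i)"]) simp_all
    qed
    have fin: "finite ?D" by simp
    have crd: "card ?D = 2 * m" by (simp add: card_cartesian_product)
    show ?thesis
      using finite_imageI[OF fin, of f] card_image[OF inj] unfolding img crd by (rule conjI)
  qed
  show ?thesis
    unfolding regular_graph_def using irrefl sym nbrs by blast
qed

end

theory Submission imports Defs begin

text \<open>
  For \<open>r = 0\<close> take the empty set. Every other cover for part (1) is a sublattice
  \<open>{x. n dvd (\<Sum>i. w\<^sub>i x\<^sub>i)}\<close>: it is an independent exact \<open>r\<close>-cover as soon as the residues \<open>\<plusminus> w\<^sub>i\<close>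
  modulo \<open>n\<close> hit every nonzero class exactly \<open>r\<close> times and never hit zero. One takes
  \<open>n = 2m + 1\<close> and \<open>w\<^sub>i = 1, \<dots>, m\<close> for \<open>r = 1\<close>, the same weights with \<open>n = m + 1\<close> for \<open>r = 2\<close>, and
  constant weights \<open>1\<close> with \<open>n = 3\<close> for \<open>r = m\<close> and \<open>n = 2\<close> for \<open>r = 2m\<close>.
  For part (2), summing the coordinates in each residue class modulo \<open>m\<close> maps \<open>\<int>\<^sup>l\<^sup>m\<close> to \<open>\<int>\<^sup>m\<close>, and
  every edge at the image of \<open>x\<close> lifts to exactly \<open>l\<close> edges at \<open>x\<close>; so the preimage of a cover is
  a cover.
\<close>

section \<open>Neighbours as signed unit steps\<close>

definition directions :: "nat \<Rightarrow> (nat \<times> int) set" where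
  "directions m = {..<m} \<times> {-1, 1}"

definition step :: "int list \<Rightarrow> nat \<times> int \<Rightarrow> int list" where
  "step v p = v[fst p := v ! fst p + snd p]"

lemma finite_directions [simp]: "finite (directions m)"
  by (simp add: directions_def)

lemma step_in_grid [simp]: "step v p \<in> grid_points m \<longleftrightarrow> v \<in> grid_points m"
  by (simp add: step_def grid_points_def)

lemma inj_on_step:
  assumes "v \<in> grid_points m"
  shows "inj_on (step v) (directions m)"
proof (rule inj_onI)
  fix p q assume p: "p \<in> directions m" and q: "q \<in> directions m" and eq: "step v p = step v q"
  have "step v p ! fst p = step v q ! fst p" using eq by simp
  then show "p = q" using assms p q
    by (auto simp: step_def directions_def grid_points_def nth_list_update split: if_splits)
qed

lemma neighbours_eq_step_image:
  assumes "v \<in> grid_points m"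
  shows "{w \<in> grid_points m. grid_adj v w} = step v ` directions m"
proof (intro equalityI subsetI)
  fix w assume "w \<in> step v ` directions m"
  then obtain i e where "i < m" "e \<in> {-1, 1}" "w = v[i := v ! i + e]"
    unfolding step_def directions_def by force
  with assms show "w \<in> {w \<in> grid_points m. grid_adj v w}"
    by (auto simp: grid_points_def grid_adj_def intro!: exI[of _ i])
next
  fix w assume "w \<in> {w \<in> grid_points m. grid_adj v w}"
  then obtain i where i: "i < m" "length w = m" "length v = m" "\<bar>v ! i - w ! i\<bar> = 1"
    and same: "\<And>j. j < m \<Longrightarrow> j \<noteq> i \<Longrightarrow> v ! j = w ! j"
    by (auto simp: grid_adj_def grid_points_def)
  have "w = step v (i, w ! i - v ! i)"
    using i same by (intro nth_equalityI) (auto simp: step_def nth_list_update)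
  moreover have "(i, w ! i - v ! i) \<in> directions m"
    using i by (auto simp: directions_def)
  ultimately show "w \<in> step v ` directions m" by blast
qed

lemma card_neighbours_in:
  assumes "v \<in> grid_points m" "S \<subseteq> grid_points m"
  shows "card {s \<in> S. grid_adj v s} = card {p \<in> directions m. step v p \<in> S}"
proof -
  have "{s \<in> S. grid_adj v s} = S \<inter> {w \<in> grid_points m. grid_adj v w}"
    using assms(2) by blast
  also have "\<dots> = step v ` {p \<in> directions m. step v p \<in> S}"
    unfolding neighbours_eq_step_image[OF assms(1)] by blast
  finally show ?thesis
    using inj_on_step[OF assms(1)] by (simp add: card_image inj_on_subset)
qed

text \<open>Distinct directions lead to distinct neighbours, so neighbours in \<open>S\<close> may
  be counted as directions. Both constructions below are checked in this form, where only the effect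
  of one step on a linear map matters.\<close>

lemma independent_exact_cover_grid_iff:
  "independent_exact_cover (grid_points m) grid_adj r S \<longleftrightarrow>
     r \<le> 2 * m \<and> S \<subseteq> grid_points m \<and>
     (\<forall>v\<in>S. \<forall>p\<in>directions m. step v p \<notin> S) \<and>
     (\<forall>v\<in>grid_points m - S. card {p \<in> directions m. step v p \<in> S} = r)"
proof -
  \<comment> \<open>The origin shows that the grid has a vertex, even for \<open>m = 0\<close>; its
    neighbourhood forces any degree \<open>d\<close> to be \<open>2 * m\<close>.\<close>
  have ne: "replicate m 0 \<in> grid_points m" by (simp add: grid_points_def)
  have deg: "(\<exists>d. regular_graph (grid_points m) grid_adj d \<and> r \<le> d) \<longleftrightarrow> r \<le> 2 * m"
  proof
    assume "\<exists>d. regular_graph (grid_points m) grid_adj d \<and> r \<le> d"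
    then obtain d where "regular_graph (grid_points m) grid_adj d" "r \<le> d" by blast
    then show "r \<le> 2 * m"
      using ne regular_graph_grid[of m] by (auto simp: regular_graph_def)
  qed (use regular_graph_grid in blast)
  have "(\<forall>u\<in>S. \<forall>v\<in>S. \<not> grid_adj u v) \<longleftrightarrow> (\<forall>v\<in>S. \<forall>p\<in>directions m. step v p \<notin> S)"
    if S: "S \<subseteq> grid_points m"
  proof -
    have "(\<forall>v\<in>S. \<not> grid_adj u v) \<longleftrightarrow> (\<forall>p\<in>directions m. step u p \<notin> S)" if "u \<in> S" for u
    proof -
      have "grid_adj u v \<longleftrightarrow> v \<in> step u ` directions m" if "v \<in> S" for v
        using neighbours_eq_step_image[of u m] S that \<open>u \<in> S\<close> by (auto simp: set_eq_iff)
      then show ?thesis by auto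
    qed
    then show ?thesis by simp
  qed
  moreover have "(\<forall>v\<in>grid_points m - S. card {s \<in> S. grid_adj v s} = r) \<longleftrightarrow>
      (\<forall>v\<in>grid_points m - S. card {p \<in> directions m. step v p \<in> S} = r)"
    if "S \<subseteq> grid_points m"
    using card_neighbours_in[of _ m S] that by simp
  ultimately show ?thesis
    unfolding independent_exact_cover_def independent_set_def deg by blast
qed

section \<open>Covers from linear forms modulo n\<close>

definition linear_form :: "nat \<Rightarrow> (nat \<Rightarrow> int) \<Rightarrow> int list \<Rightarrow> int" where
  "linear_form m w x = (\<Sum>i<m. w i * x ! i)"

lemma linear_form_step:
  assumes "x \<in> grid_points m" "i < m"
  shows "linear_form m w (step x (i, e)) = linear_form m w x + e * w i"
proof -
  have "linear_form m w (step x (i, e)) = (\<Sum>k<m. w k * x ! k + (if k = i then e * w i else 0))"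
    unfolding linear_form_def
    using assms by (intro sum.cong) (auto simp: step_def grid_points_def nth_list_update algebra_simps)
  also have "\<dots> = linear_form m w x + e * w i"
    using assms(2) by (simp add: sum.distrib linear_form_def)
  finally show ?thesis .
qed

text \<open>A step \<open>(i, e)\<close> adds \<open>e * w i\<close> to the form. From a point of
  value \<open>a\<close>, the step with \<open>e = -1\<close> enters the lattice iff
  \<open>n dvd a - w i\<close>, the one with \<open>e = 1\<close> iff \<open>n dvd a + w i\<close>.
  The latter is written with \<open>- a - w i\<close>, so that one counting lemma can serve both
  \<open>a\<close> and \<open>- a\<close>.\<close>

lemma linear_cover:
  assumes r: "r \<le> 2 * m"
    and nz: "\<And>i. i < m \<Longrightarrow> \<not> n dvd w i"
    and cnt: "\<And>a. \<not> n dvd a \<Longrightarrow>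
      card {i. i < m \<and> n dvd a - w i} + card {i. i < m \<and> n dvd - a - w i} = r"
  shows "independent_exact_cover (grid_points m) grid_adj r
    {x \<in> grid_points m. n dvd linear_form m w x}"
  unfolding independent_exact_cover_grid_iff
proof (intro conjI ballI r)
  fix v p assume v: "v \<in> {x \<in> grid_points m. n dvd linear_form m w x}" and p: "p \<in> directions m"
  then show "step v p \<notin> {x \<in> grid_points m. n dvd linear_form m w x}"
    by (auto simp: directions_def linear_form_step nz dvd_add_right_iff dvd_diff_right_iff)
next
  fix v assume "v \<in> grid_points m - {x \<in> grid_points m. n dvd linear_form m w x}"
  then have v: "v \<in> grid_points m" and nd: "\<not> n dvd linear_form m w v" by auto
  let ?a = "linear_form m w v"
  let ?A = "{i. i < m \<and> n dvd ?a - w i}" and ?B = "{i. i < m \<and> n dvd - ?a - w i}"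
  have neg: "n dvd ?a + w i \<longleftrightarrow> n dvd - ?a - w i" for i
    using dvd_minus_iff[of n "?a + w i"] by simp
  have "{p \<in> directions m. step v p \<in> {x \<in> grid_points m. n dvd linear_form m w x}}
      = (\<lambda>i. (i, -1)) ` ?A \<union> (\<lambda>i. (i, 1)) ` ?B"
    using v by (auto simp: directions_def linear_form_step neg)
  moreover have "card \<dots> = card ?A + card ?B"
    by (subst card_Un_disjoint) (auto simp: card_image inj_on_def)
  ultimately show "card {p \<in> directions m. step v p \<in> {x \<in> grid_points m. n dvd linear_form m w x}} = r"
    using cnt[OF nd] by simp
qed auto

text \<open>The weights 1, ..., m are their own residues because \<open>int m < n\<close>, so the
  only possible index is \<open>a mod n - 1\<close>.\<close>

lemma card_consecutive_congruent:
  fixes n a :: int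
  assumes "int m < n"
  shows "card {i. i < m \<and> n dvd a - (int i + 1)} = (if 1 \<le> a mod n \<and> a mod n \<le> int m then 1 else 0)"
proof -
  have "n dvd a - (int i + 1) \<longleftrightarrow> a mod n = int i + 1" if "i < m" for i
    using that assms by (simp flip: mod_eq_dvd_iff)
  then have "{i. i < m \<and> n dvd a - (int i + 1)} =
      (if 1 \<le> a mod n \<and> a mod n \<le> int m then {nat (a mod n - 1)} else {})"
    by auto
  then show ?thesis by simp
qed

text \<open>Negation swaps the residues 1, ..., m with m + 1, ..., 2m modulo 2m + 1, so exactly one
  of \<open>a\<close> and \<open>- a\<close> is hit by a weight.\<close>

lemma perfect_code_grid: "\<exists>S. independent_exact_cover (grid_points m) grid_adj 1 S" if "m \<ge> 1"
proof (rule exI, rule linear_cover[where n = "2 * int m + 1" and w = "\<lambda>i. int i + 1"])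
  fix a :: int assume nd: "\<not> 2 * int m + 1 dvd a"
  then have "a mod (2 * int m + 1) \<noteq> 0" by (simp add: dvd_eq_mod_eq_0)
  moreover have "a mod (2 * int m + 1) \<ge> 0" by (rule pos_mod_sign) simp
  ultimately have "1 \<le> a mod (2 * int m + 1)" by linarith
  moreover have "a mod (2 * int m + 1) < 2 * int m + 1" by (rule pos_mod_bound) simp
  ultimately show "card {i. i < m \<and> 2 * int m + 1 dvd a - (int i + 1)} +
      card {i. i < m \<and> 2 * int m + 1 dvd - a - (int i + 1)} = 1"
    by (simp add: card_consecutive_congruent zmod_zminus1_eq_if)
next
  show "1 \<le> 2 * m" using that by simp
next
  fix i assume "i < m"
  then show "\<not> 2 * int m + 1 dvd int i + 1" by (intro zdvd_not_zless) simp_all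
qed

text \<open>Modulo m + 1 the weights already exhaust the nonzero residues, so \<open>a\<close> and
  \<open>- a\<close> are each hit once.\<close>

lemma exact_2_cover_grid: "\<exists>S. independent_exact_cover (grid_points m) grid_adj 2 S" if "m \<ge> 1"
proof (rule exI, rule linear_cover[where n = "int m + 1" and w = "\<lambda>i. int i + 1"])
  fix a :: int assume nd: "\<not> int m + 1 dvd a"
  then have "a mod (int m + 1) \<noteq> 0" by (simp add: dvd_eq_mod_eq_0)
  moreover have "a mod (int m + 1) \<ge> 0" by (rule pos_mod_sign) simp
  ultimately have "1 \<le> a mod (int m + 1)" by linarith
  moreover have "a mod (int m + 1) < int m + 1" by (rule pos_mod_bound) simp
  ultimately show "card {i. i < m \<and> int m + 1 dvd a - (int i + 1)} +
      card {i. i < m \<and> int m + 1 dvd - a - (int i + 1)} = 2"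
    by (simp add: card_consecutive_congruent zmod_zminus1_eq_if)
next
  show "2 \<le> 2 * m" using that by simp
next
  fix i assume "i < m"
  then show "\<not> int m + 1 dvd int i + 1" by (intro zdvd_not_zless) simp_all
qed

text \<open>A nonzero \<open>a\<close> is 1 or -1 modulo 3, so one of the two index sets is
  everything and the other is empty.\<close>

lemma exact_m_cover_grid: "\<exists>S. independent_exact_cover (grid_points m) grid_adj m S"
proof (rule exI, rule linear_cover[where n = 3 and w = "\<lambda>_. 1"])
  fix a :: int assume "\<not> 3 dvd a"
  then have "(3 dvd a - 1) \<noteq> (3 dvd - a - 1)" by presburger
  then show "card {i. i < m \<and> 3 dvd a - 1} + card {i. i < m \<and> 3 dvd - a - 1} = m"
    by auto
qed auto

text \<open>The cover is one class of the bipartition by parity of the coordinate sum.\<close>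

lemma exact_2m_cover_grid: "\<exists>S. independent_exact_cover (grid_points m) grid_adj (2 * m) S"
proof (rule exI, rule linear_cover[where n = 2 and w = "\<lambda>_. 1"])
  fix a :: int assume "\<not> 2 dvd a"
  then have "2 dvd a - 1" "2 dvd - a - 1" by presburger+
  then show "card {i. i < m \<and> 2 dvd a - 1} + card {i. i < m \<and> 2 dvd - a - 1} = 2 * m"
    by simp
qed auto

lemma exact_0_cover_grid: "independent_exact_cover (grid_points m) grid_adj 0 {}"
  by (simp add: independent_exact_cover_grid_iff)

section \<open>Folding l blocks of coordinates onto one\<close>

definition fold_grid :: "nat \<Rightarrow> nat \<Rightarrow> int list \<Rightarrow> int list" where
  "fold_grid l m x = map (\<lambda>j. \<Sum>k<l. x ! (k * m + j)) [0..<m]"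

lemma fold_grid_in_grid: "fold_grid l m x \<in> grid_points m"
  by (simp add: fold_grid_def grid_points_def)

text \<open>Folding is additive and sends the unit vector at offset \<open>j\<close> of any block to
  the unit vector at \<open>j\<close>.\<close>

lemma fold_grid_step:
  assumes x: "x \<in> grid_points (l * m)" and k: "k < l" and j: "j < m"
  shows "fold_grid l m (step x (k * m + j, e)) = step (fold_grid l m x) (j, e)"
proof (rule nth_equalityI)
  show "length (fold_grid l m (step x (k * m + j, e))) = length (step (fold_grid l m x) (j, e))"
    by (simp add: fold_grid_def step_def)
next
  fix j' assume "j' < length (fold_grid l m (step x (k * m + j, e)))"
  then have j': "j' < m" by (simp add: fold_grid_def)
  \<comment> \<open>Since both offsets are below \<open>m\<close>, division with remainder recovers
    block and offset from the position. Hence the altered entry occurs in one summand only, and only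
    in the sum for \<open>j\<close>.\<close>
  have eq: "k' * m + j' = k * m + j \<longleftrightarrow> k' = k \<and> j' = j" for k'
  proof
    assume *: "k' * m + j' = k * m + j"
    then have "(k' * m + j') mod m = (k * m + j) mod m" by simp
    then have "j' = j" using j j' by simp
    then show "k' = k \<and> j' = j" using * j by simp
  qed simp
  have eq': "k * m + j = k' * m + j' \<longleftrightarrow> k' = k \<and> j' = j" for k'
    using eq[of k'] by (simp add: eq_commute)
  \<comment> \<open>The altered position lies inside the list; an update out of range would change
    nothing.\<close>
  have lt: "k' * m + j'' < l * m" if "k' < l" "j'' < m" for k' j''
  proof -
    have "k' * m + j'' < Suc k' * m" using that by simp
    also have "\<dots> \<le> l * m" using that(1) by (intro mult_le_mono1) simp
    finally show ?thesis .
  qed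
  have "fold_grid l m (step x (k * m + j, e)) ! j' =
      (\<Sum>k'<l. x ! (k' * m + j') + (if k' = k then if j' = j then e else 0 else 0))"
    using j' x lt[OF k j] unfolding fold_grid_def
    by (auto simp: step_def grid_points_def nth_list_update eq eq' intro!: sum.cong)
  also have "\<dots> = step (fold_grid l m x) (j, e) ! j'"
    using j' k by (simp add: sum.distrib step_def fold_grid_def nth_list_update)
  finally show "fold_grid l m (step x (k * m + j, e)) ! j' = step (fold_grid l m x) (j, e) ! j'" .
qed

text \<open>Division with remainder by \<open>m\<close> gives the inverse. Each direction of the
  small grid thus has \<open>l\<close> lifts, one per block.\<close>

lemma bij_betw_directions_mult:
  "bij_betw (\<lambda>(k, j, e). (k * m + j, e)) ({..<l} \<times> directions m) (directions (l * m))"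
proof (rule bij_betw_byWitness[where f' = "\<lambda>(i, e). (i div m, i mod m, e)"])
  show "(\<lambda>(k, j, e). (k * m + j, e)) ` ({..<l} \<times> directions m) \<subseteq> directions (l * m)"
  proof clarsimp
    fix k j :: nat and e :: int
    assume "k < l" "(j, e) \<in> directions m"
    moreover from this have "Suc k * m \<le> l * m" by (intro mult_le_mono1) simp
    ultimately show "(k * m + j, e) \<in> directions (l * m)"
      by (auto simp: directions_def)
  qed
  \<comment> \<open>The bound \<open>i mod m < m\<close> requires positive \<open>m\<close>; for
    \<open>m = 0\<close> there are no directions.\<close>
  show "(\<lambda>(i, e). (i div m, i mod m, e)) ` directions (l * m) \<subseteq> {..<l} \<times> directions m"
    by (auto simp: directions_def less_mult_imp_div_less) (cases m; simp)+
qed (auto simp: directions_def)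

text \<open>A lifted step stays in or enters the preimage exactly when the step below does so in
  \<open>S\<close>. Independence is therefore inherited, and each count is multiplied by the number
  \<open>l\<close> of lifts.\<close>

lemma fold_grid_cover:
  assumes "independent_exact_cover (grid_points m) grid_adj r S"
  shows "independent_exact_cover (grid_points (l * m)) grid_adj (l * r)
    {x \<in> grid_points (l * m). fold_grid l m x \<in> S}" (is "independent_exact_cover _ _ _ ?T")
proof -
  let ?g = "\<lambda>(k, j, e). (k * m + j, e)"
  have r: "r \<le> 2 * m"
    and ind: "\<And>v p. v \<in> S \<Longrightarrow> p \<in> directions m \<Longrightarrow> step v p \<notin> S"
    and cnt: "\<And>v. v \<in> grid_points m - S \<Longrightarrow> card {p \<in> directions m. step v p \<in> S} = r"
    using assms unfolding independent_exact_cover_grid_iff by blast+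
  have lift: "step x (?g (k, p)) \<in> ?T \<longleftrightarrow> step (fold_grid l m x) p \<in> S"
    if "x \<in> grid_points (l * m)" "k < l" "p \<in> directions m" for x k p
    using that by (auto simp: directions_def fold_grid_step)
  have dirs: "directions (l * m) = ?g ` ({..<l} \<times> directions m)"
    using bij_betw_directions_mult[of m l] by (simp add: bij_betw_def)
  show ?thesis
    unfolding independent_exact_cover_grid_iff
  proof (intro conjI ballI)
    show "l * r \<le> 2 * (l * m)" using mult_le_mono2[OF r, of l] by (simp add: mult.left_commute)
  next
    fix x q assume x: "x \<in> ?T" and "q \<in> directions (l * m)"
    then obtain k p where "k < l" "p \<in> directions m" "q = ?g (k, p)"
      unfolding dirs by blast
    then show "step x q \<notin> ?T" using x lift[of x k p] ind by blast
  next
    fix x assume "x \<in> grid_points (l * m) - ?T"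
    then have x: "x \<in> grid_points (l * m)" and nS: "fold_grid l m x \<notin> S" by auto
    let ?P = "{p \<in> directions m. step (fold_grid l m x) p \<in> S}"
    have "{q \<in> directions (l * m). step x q \<in> ?T} = ?g ` ({..<l} \<times> ?P)"
      unfolding dirs using lift[OF x] by blast
    moreover have "inj_on ?g ({..<l} \<times> ?P)"
      using bij_betw_directions_mult[of m l] by (auto simp: bij_betw_def elim!: inj_on_subset)
    ultimately have "card {q \<in> directions (l * m). step x q \<in> ?T} = l * card ?P"
      by (simp add: card_image card_cartesian_product)
    then show "card {q \<in> directions (l * m). step x q \<in> ?T} = l * r"
      using cnt nS fold_grid_in_grid by simp
  qed auto
qed

theorem theorem4:
  "(\<forall>m::nat. m \<ge> 2 \<longrightarrow>
      (\<forall>r \<in> {0, 1, 2, m, 2 * m}. \<exists>S. independent_exact_cover (grid_points m) grid_adj r S))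
   \<and>
   (\<forall>(m::nat) (r::nat).
      (\<exists>S. independent_exact_cover (grid_points m) grid_adj r S) \<longrightarrow>
      (\<forall>l::nat. \<exists>T. independent_exact_cover (grid_points (l * m)) grid_adj (l * r) T))"
proof (intro conjI allI impI ballI)
  fix m r :: nat
  assume "m \<ge> 2" and "r \<in> {0, 1, 2, m, 2 * m}"
  then consider "r = 0" | "r = 1" | "r = 2" | "r = m" | "r = 2 * m" by blast
  then show "\<exists>S. independent_exact_cover (grid_points m) grid_adj r S"
  proof cases
    case 1 with exact_0_cover_grid show ?thesis by blast
  next
    case 2 with perfect_code_grid[of m] \<open>m \<ge> 2\<close> show ?thesis by simp
  next
    case 3 with exact_2_cover_grid[of m] \<open>m \<ge> 2\<close> show ?thesis by simp
  next
    case 4 with exact_m_cover_grid[of m] show ?thesis by simp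
  next
    case 5 with exact_2m_cover_grid[of m] show ?thesis by simp
  qed
next
  fix m r l :: nat
  assume "\<exists>S. independent_exact_cover (grid_points m) grid_adj r S"
  then obtain S where "independent_exact_cover (grid_points m) grid_adj r S" ..
  from fold_grid_cover[OF this, of l]
  show "\<exists>T. independent_exact_cover (grid_points (l * m)) grid_adj (l * r) T" ..
qed

end
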